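(* Let $A$ be a Banach algebra. Then the following properties are equivalent: (1) the algebra $A$ is a zero Lie product determined Banach algebra; (2) for each Banach space $X$, every continuous bilinear map $\varphi\colon A\times A\to X$ with the property that $\varphi(a,b)=0$ whenever $a,b\in A$ are such that $[a,b]=0$ is of the form $\varphi(a,b)=T([a,b])$ $(a,b\in A)$ for a unique continuous linear map $T\colon [A,A]\to X$.
   Context: Banach algebras (not assumed unital) and Banach spaces are over $\mathbb{C}$. For $a,b\in A$, $[a,b]=ab-ba$. $[A,A]$ denotes the linear span of all commutators $[a,b]$ ($a,b\in A$), with the norm inherited from $A$. $A^*$ denotes the dual (space of continuous linear functionals) of $A$. A Banach algebra $A$ is called zero Lie product determined if for every continuous bilinear functional $\varphi\colon A\times A\to\mathbb{C}$ satisfying: for all $a,b\in A$, $[a,b]=0$ implies $\varphi(a,b)=0$, there exists $\tau\in A^*$ such that $\varphi(a,b)=\tau([a,b])$ for all $a,b\in A$. *)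

theory Defs
  imports "HOL-Analysis.Analysis"
begin

section \<open>Complex Banach algebras\<close>

text \<open>
  The classes \<^class>\<open>real_normed_algebra\<close> and \<^class>\<open>banach\<close> supply a complete, submultiplicative,
  not necessarily unital normed algebra over the reals. A complex Banach algebra is such an algebra
  with a compatible complex scalar multiplication.
\<close>

class complex_banach_algebra = real_normed_algebra + banach +
  fixes scaleC :: "complex \<Rightarrow> 'a \<Rightarrow> 'a"  (infixr "*\<^sub>C" 75)
  assumes scaleC_add_right: "c *\<^sub>C (x + y) = c *\<^sub>C x + c *\<^sub>C y"
    and scaleC_add_left: "(c + d) *\<^sub>C x = c *\<^sub>C x + d *\<^sub>C x"
    and scaleC_scaleC: "c *\<^sub>C d *\<^sub>C x = (c * d) *\<^sub>C x"
    and scaleR_scaleC: "r *\<^sub>R x = complex_of_real r *\<^sub>C x"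
    and norm_scaleC: "norm (c *\<^sub>C x) = cmod c * norm x"
    and mult_scaleC_left: "(c *\<^sub>C x) * y = c *\<^sub>C (x * y)"
    and mult_scaleC_right: "x * (c *\<^sub>C y) = c *\<^sub>C (x * y)"

instantiation complex :: complex_banach_algebra
begin

definition scaleC_complex :: "complex \<Rightarrow> complex \<Rightarrow> complex"
  where "scaleC_complex c z = c * z"

instance
  by standard (simp_all add: scaleC_complex_def algebra_simps norm_mult scaleR_conv_of_real)

end

lemma scaleC_one: "1 *\<^sub>C x = (x :: 'a::complex_banach_algebra)"
  using scaleR_scaleC[of 1 x] by simp

lemma vector_space_scaleC:
  "vector_space (scaleC :: complex \<Rightarrow> 'a \<Rightarrow> 'a::complex_banach_algebra)"
  by standard (simp_all add: scaleC_add_right scaleC_add_left scaleC_scaleC scaleC_one)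

definition commutator :: "'a::complex_banach_algebra \<Rightarrow> 'a \<Rightarrow> 'a"
  where "commutator a b = a * b - b * a"

definition commutator_span :: "'a::complex_banach_algebra set"
  where "commutator_span = module.span scaleC {commutator a b | a b. True}"

definition zero_lie_product_determined :: "'a::complex_banach_algebra itself \<Rightarrow> bool"
  where "zero_lie_product_determined (_ :: 'a itself) \<longleftrightarrow>
    (\<forall>\<phi> :: 'a \<Rightarrow> 'a \<Rightarrow> complex.
      (\<forall>a. Vector_Spaces.linear scaleC (*) (\<lambda>b. \<phi> a b)) \<longrightarrow>
      (\<forall>b. Vector_Spaces.linear scaleC (*) (\<lambda>a. \<phi> a b)) \<longrightarrow>
      continuous_on UNIV (\<lambda>(a, b). \<phi> a b) \<longrightarrow>
      (\<forall>a b. commutator a b = 0 \<longrightarrow> \<phi> a b = 0) \<longrightarrow>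
      (\<exists>\<tau> :: 'a \<Rightarrow> complex.
        Vector_Spaces.linear scaleC (*) \<tau> \<and> continuous_on UNIV \<tau> \<and>
        (\<forall>a b. \<phi> a b = \<tau> (commutator a b))))"


section \<open>Complex Banach spaces as sets with structure\<close>

text \<open>
  Quantifying over all Banach spaces inside a formula requires Banach spaces to be values rather
  than types: the underlying set is an arbitrary subset of a type, and the operations are only
  constrained on that set.
\<close>

record 'x complex_normed_struct =
  points :: "'x set"
  vadd :: "'x \<Rightarrow> 'x \<Rightarrow> 'x"
  vzero :: "'x"
  vscale :: "complex \<Rightarrow> 'x \<Rightarrow> 'x"
  vnorm :: "'x \<Rightarrow> real"

text \<open>The value 0 off the set makes this total function satisfy the locale \<^locale>\<open>Metric_space\<close>.\<close>

definition vdist :: "'x complex_normed_struct \<Rightarrow> 'x \<Rightarrow> 'x \<Rightarrow> real"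
  where "vdist X x y =
    (if x \<in> points X \<and> y \<in> points X then vnorm X (vadd X x (vscale X (-1) y)) else 0)"

definition vtopology :: "'x complex_normed_struct \<Rightarrow> 'x topology"
  where "vtopology X = Metric_space.mtopology (points X) (vdist X)"

locale complex_normed_space =
  fixes X :: "'x complex_normed_struct"
  assumes add_closed: "x \<in> points X \<Longrightarrow> y \<in> points X \<Longrightarrow> vadd X x y \<in> points X"
    and zero_closed: "vzero X \<in> points X"
    and scale_closed: "x \<in> points X \<Longrightarrow> vscale X c x \<in> points X"
    and add_assoc: "x \<in> points X \<Longrightarrow> y \<in> points X \<Longrightarrow> z \<in> points X \<Longrightarrow>
      vadd X (vadd X x y) z = vadd X x (vadd X y z)"
    and add_commute: "x \<in> points X \<Longrightarrow> y \<in> points X \<Longrightarrow> vadd X x y = vadd X y x"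
    and add_zero: "x \<in> points X \<Longrightarrow> vadd X x (vzero X) = x"
    and add_inverse: "x \<in> points X \<Longrightarrow> \<exists>y\<in>points X. vadd X x y = vzero X"
    and scale_add_right: "x \<in> points X \<Longrightarrow> y \<in> points X \<Longrightarrow>
      vscale X c (vadd X x y) = vadd X (vscale X c x) (vscale X c y)"
    and scale_add_left: "x \<in> points X \<Longrightarrow>
      vscale X (c + d) x = vadd X (vscale X c x) (vscale X d x)"
    and scale_scale: "x \<in> points X \<Longrightarrow> vscale X c (vscale X d x) = vscale X (c * d) x"
    and scale_one: "x \<in> points X \<Longrightarrow> vscale X 1 x = x"
    and norm_nonneg: "x \<in> points X \<Longrightarrow> 0 \<le> vnorm X x"
    and norm_eq_zero: "x \<in> points X \<Longrightarrow> vnorm X x = 0 \<longleftrightarrow> x = vzero X"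
    and norm_scale: "x \<in> points X \<Longrightarrow> vnorm X (vscale X c x) = cmod c * vnorm X x"
    and norm_triangle: "x \<in> points X \<Longrightarrow> y \<in> points X \<Longrightarrow>
      vnorm X (vadd X x y) \<le> vnorm X x + vnorm X y"
begin

lemma scale_zero_left:
  assumes x: "x \<in> points X"
  shows "vscale X 0 x = vzero X"
proof -
  let ?z = "vscale X 0 x"
  have z: "?z \<in> points X" using x by (rule scale_closed)
  obtain w where w: "w \<in> points X" "vadd X ?z w = vzero X" using add_inverse[OF z] by blast
  have "vadd X ?z ?z = ?z" using scale_add_left[OF x, of 0 0] by simp
  then have "vadd X ?z (vadd X ?z w) = vadd X ?z w" using add_assoc[OF z z w(1)] by simp
  then show ?thesis using w add_zero[OF z] by simp
qed

lemma add_minus: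
  assumes x: "x \<in> points X"
  shows "vadd X x (vscale X (-1) x) = vzero X"
  using scale_add_left[OF x, of 1 "-1"] scale_one[OF x] scale_zero_left[OF x] by simp

lemma diff_add_diff:
  assumes x: "x \<in> points X" and y: "y \<in> points X" and z: "z \<in> points X"
  shows "vadd X (vadd X x (vscale X (-1) y)) (vadd X y (vscale X (-1) z))
    = vadd X x (vscale X (-1) z)"
proof -
  let ?y = "vscale X (-1) y" and ?z = "vscale X (-1) z"
  have cl: "?y \<in> points X" "?z \<in> points X" using y z by (simp_all add: scale_closed)
  have "vadd X ?y (vadd X y ?z) = vadd X (vadd X ?y y) ?z"
    using add_assoc cl y by simp
  also have "\<dots> = vadd X ?z (vzero X)"
    using add_commute add_minus[OF y] cl y zero_closed by simp
  also have "\<dots> = ?z" using add_zero cl by simp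
  finally show ?thesis using add_assoc[OF x cl(1)] add_closed[OF y cl(2)] by simp
qed

sublocale Metric_space "points X" "vdist X"
proof
  show "0 \<le> vdist X x y" for x y
    by (simp add: vdist_def norm_nonneg add_closed scale_closed)
  show "vdist X x y = vdist X y x" for x y
  proof (cases "x \<in> points X \<and> y \<in> points X")
    case True
    let ?x = "vscale X (-1) x" and ?y = "vscale X (-1) y"
    have cl: "?x \<in> points X" "?y \<in> points X" using True by (simp_all add: scale_closed)
    have "vscale X (-1) (vadd X x ?y) = vadd X ?x y"
      using True cl by (simp add: scale_add_right scale_scale scale_one)
    also have "\<dots> = vadd X y ?x" using True cl by (simp add: add_commute)
    finally have "vnorm X (vadd X y ?x) = vnorm X (vadd X x ?y)"
      using norm_scale[of "vadd X x ?y" "-1"] True cl by (simp add: add_closed)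
    then show ?thesis using True by (simp add: vdist_def)
  qed (auto simp: vdist_def)
  show "vdist X x y = 0 \<longleftrightarrow> x = y" if x: "x \<in> points X" and y: "y \<in> points X" for x y
  proof
    assume "vdist X x y = 0"
    then have xy: "vadd X x (vscale X (-1) y) = vzero X"
      using x y by (simp add: vdist_def norm_eq_zero add_closed scale_closed)
    have "vadd X (vadd X x (vscale X (-1) y)) y = vadd X x (vadd X (vscale X (-1) y) y)"
      using x y by (simp add: add_assoc scale_closed)
    also have "\<dots> = x"
      using x y add_minus[OF y] by (simp add: add_commute scale_closed add_zero)
    finally show "x = y" using xy y add_zero[OF y] add_commute[OF zero_closed y] by simp
  qed (use x in \<open>simp add: vdist_def add_minus norm_eq_zero zero_closed\<close>)
  show "vdist X x z \<le> vdist X x y + vdist X y z"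
    if x: "x \<in> points X" and y: "y \<in> points X" and z: "z \<in> points X" for x y z
    using norm_triangle[of "vadd X x (vscale X (-1) y)" "vadd X y (vscale X (-1) z)"]
      diff_add_diff[OF x y z] x y z
    by (simp add: vdist_def add_closed scale_closed)
qed

end

locale complex_banach_space = complex_normed_space X for X :: "'x complex_normed_struct" +
  assumes complete: mcomplete

lemma complex_banach_space_complex:
  "complex_banach_space \<lparr>points = UNIV, vadd = (+), vzero = 0, vscale = (*), vnorm = cmod\<rparr>"
    (is "complex_banach_space ?C")
proof -
  interpret complex_normed_space ?C
    by standard (auto simp: algebra_simps norm_mult norm_triangle_ineq intro: exI[of _ "- _"])
  have "vdist ?C = dist"
    by (simp add: fun_eq_iff vdist_def dist_norm)
  then have mcomplete
    using complete_UNIV mcomplete_iff_complete by auto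
  then show ?thesis by unfold_locales
qed

text \<open>Linearity of a map from a complex-linear subspace of an algebra into a Banach space:\<close>

definition linear_into ::
    "'a::complex_banach_algebra set \<Rightarrow> 'x complex_normed_struct \<Rightarrow> ('a \<Rightarrow> 'x) \<Rightarrow> bool"
  where "linear_into V X f \<longleftrightarrow>
    (\<forall>u\<in>V. f u \<in> points X) \<and>
    (\<forall>u\<in>V. \<forall>v\<in>V. f (u + v) = vadd X (f u) (f v)) \<and>
    (\<forall>c. \<forall>u\<in>V. f (c *\<^sub>C u) = vscale X c (f u))"

end

theory Submission
  imports Defs
begin

text \<open>
  Suppose the scalar property holds and let \<open>\<phi>\<close> take values in a Banach space \<open>X\<close>. Every bounded
  functional \<open>\<xi>\<close> on \<open>X\<close> yields a functional \<open>\<tau>\<close> on the algebra with \<open>\<xi> (\<phi> a b) = \<tau> [a, b]\<close>. As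
  bounded functionals separate the points of \<open>X\<close>, the assignment \<open>[a, b] \<mapsto> \<phi> a b\<close> extends to a
  well-defined linear map \<open>T\<close> on the span of the commutators. The image of the unit ball under
  \<open>T\<close> is weakly bounded, since \<open>\<xi> \<circ> T\<close> is a restriction of \<open>\<tau>\<close>; hence it is bounded in norm.
  Conversely, take \<open>X\<close> to be a copy of the scalar field inside the type of values, and extend
  the functional obtained on the span of the commutators by the Hahn--Banach theorem.
\<close>

section \<open>The Hahn--Banach theorem\<close>

context complex_normed_space
begin

lemma add_left_commute:
  assumes "x \<in> points X" "y \<in> points X" "z \<in> points X"
  shows "vadd X x (vadd X y z) = vadd X y (vadd X x z)"
  using assms add_assoc[of x y z] add_assoc[of y x z] add_commute[of x y] by simp

lemma scale_zero_right: "vscale X c (vzero X) = vzero X"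
  using scale_zero_left[OF zero_closed] scale_scale[OF zero_closed, of c 0] by simp

lemma eq_if_diff_eq_zero:
  assumes x: "x \<in> points X" and y: "y \<in> points X" and eq: "vadd X x (vscale X (-1) y) = vzero X"
  shows "x = y"
proof -
  have "vdist X x y = 0"
    using x y eq by (simp add: vdist_def norm_eq_zero zero_closed)
  then show ?thesis using x y by simp
qed

text \<open>A partial real-linear functional is encoded by its graph, so that extension is inclusion
  and the upper bound of a chain is its union, as suits Zorn's lemma. Single-valuedness is not a
  clause: it follows from the last one.\<close>

definition dominated_graph :: "real \<Rightarrow> ('x \<times> real) set \<Rightarrow> bool"
  where "dominated_graph C G \<longleftrightarrow>
    G \<subseteq> points X \<times> UNIV \<and> (vzero X, 0) \<in> G \<and>
    (\<forall>x r y s. (x, r) \<in> G \<longrightarrow> (y, s) \<in> G \<longrightarrow> (vadd X x y, r + s) \<in> G) \<and>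
    (\<forall>x r t. (x, r) \<in> G \<longrightarrow> (vscale X (complex_of_real t) x, t * r) \<in> G) \<and>
    (\<forall>x r. (x, r) \<in> G \<longrightarrow> r \<le> C * vnorm X x)"

lemma dominated_graphD:
  assumes "dominated_graph C G"
  shows "(x, r) \<in> G \<Longrightarrow> x \<in> points X"
    and "(vzero X, 0) \<in> G"
    and "(x, r) \<in> G \<Longrightarrow> (y, s) \<in> G \<Longrightarrow> (vadd X x y, r + s) \<in> G"
    and "(x, r) \<in> G \<Longrightarrow> (vscale X (complex_of_real t) x, t * r) \<in> G"
    and "(x, r) \<in> G \<Longrightarrow> r \<le> C * vnorm X x"
  using assms unfolding dominated_graph_def by blast+

text \<open>The difference of two values at \<open>x\<close> is a value at the zero vector, where
  domination makes it at most 0. Exchanging the two values gives the other inequality.\<close>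

lemma dominated_graph_unique:
  assumes G: "dominated_graph C G" and r: "(x, r) \<in> G" and s: "(x, s) \<in> G"
  shows "r = s"
proof -
  have x: "x \<in> points X" using dominated_graphD(1)[OF G r] .
  have *: "r' \<le> s'" if "(x, r') \<in> G" "(x, s') \<in> G" for r' s'
  proof -
    have "(vadd X x (vscale X (complex_of_real (-1)) x), r' + (-1) * s') \<in> G"
      using that by (intro dominated_graphD(3)[OF G] dominated_graphD(4)[OF G])
    then have "(vzero X, r' - s') \<in> G" using add_minus[OF x] by simp
    from dominated_graphD(5)[OF G this] show ?thesis
      using norm_eq_zero[OF zero_closed] by simp
  qed
  show ?thesis using *[OF r s] *[OF s r] by simp
qed

text \<open>The one-dimensional step. The two conditions bound \<open>\<alpha>\<close> from below by
  the numbers \<open>r - C * ||y - a||\<close> and from above by the numbers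
  \<open>C * ||z + a|| - s\<close>. Every lower bound is at most every upper bound by the triangle
  inequality, so the supremum of the lower bounds serves.\<close>

lemma dominated_extension_value:
  assumes G: "dominated_graph C G" and C: "0 \<le> C" and a: "a \<in> points X"
  obtains \<alpha> where
    "\<And>y r. (y, r) \<in> G \<Longrightarrow> r + \<alpha> \<le> C * vnorm X (vadd X y a)"
    "\<And>y r. (y, r) \<in> G \<Longrightarrow> r - \<alpha> \<le> C * vnorm X (vadd X y (vscale X (-1) a))"
proof -
  let ?m = "vscale X (-1) a"
  let ?L = "{r - C * vnorm X (vadd X y ?m) | y r. (y, r) \<in> G}"
  have m: "?m \<in> points X" using a by (rule scale_closed)
  have key: "r - C * vnorm X (vadd X y ?m) \<le> C * vnorm X (vadd X z a) - s"
    if yr: "(y, r) \<in> G" and zs: "(z, s) \<in> G" for y r z s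
  proof -
    have y: "y \<in> points X" and z: "z \<in> points X"
      using dominated_graphD(1)[OF G] yr zs by blast+
    have eq: "vadd X (vadd X y ?m) (vadd X z a) = vadd X y z"
    proof -
      have "vadd X ?m (vadd X z a) = vadd X z (vadd X ?m a)"
        using add_left_commute m z a by blast
      also have "\<dots> = z" using add_commute[OF m a] add_minus[OF a] add_zero[OF z] by simp
      finally show ?thesis using add_assoc[OF y m add_closed[OF z a]] by simp
    qed
    have "r + s \<le> C * vnorm X (vadd X y z)"
      using dominated_graphD(5)[OF G dominated_graphD(3)[OF G yr zs]] .
    also have "\<dots> \<le> C * (vnorm X (vadd X y ?m) + vnorm X (vadd X z a))"
      using norm_triangle[OF add_closed[OF y m] add_closed[OF z a]] C eq
      by (simp add: mult_left_mono)
    finally show ?thesis by (simp add: algebra_simps)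
  qed
  have zero: "(vzero X, 0) \<in> G" using dominated_graphD(2)[OF G] .
  have ne: "?L \<noteq> {}" using zero by blast
  have bdd: "bdd_above ?L"
    using key[OF _ zero] by (intro bdd_aboveI) blast
  show ?thesis
  proof
    fix y r assume yr: "(y, r) \<in> G"
    have "r - C * vnorm X (vadd X y ?m) \<le> Sup ?L"
      using yr by (intro cSup_upper[OF _ bdd]) blast
    then show "r - Sup ?L \<le> C * vnorm X (vadd X y ?m)" by simp
    have "Sup ?L \<le> C * vnorm X (vadd X y a) - r"
      using key[OF _ yr] by (intro cSup_least[OF ne]) blast
    then show "r + Sup ?L \<le> C * vnorm X (vadd X y a)" by simp
  qed
qed

text \<open>The graph grows by all real multiples of \<open>a\<close>, with value
  \<open>\<alpha>\<close> at \<open>a\<close>. A vector \<open>a\<close> already in the domain needs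
  no separate case: the larger graph is still dominated, hence still single-valued.\<close>

lemma dominated_graph_extend:
  assumes G: "dominated_graph C G" and C: "0 \<le> C" and a: "a \<in> points X"
  obtains H \<alpha> where "dominated_graph C H" "G \<subseteq> H" "(a, \<alpha>) \<in> H"
proof -
  obtain \<alpha> where
    plus: "\<And>y r. (y, r) \<in> G \<Longrightarrow> r + \<alpha> \<le> C * vnorm X (vadd X y a)" and
    minus: "\<And>y r. (y, r) \<in> G \<Longrightarrow> r - \<alpha> \<le> C * vnorm X (vadd X y (vscale X (-1) a))"
    using dominated_extension_value[OF assms] by blast
  let ?s = "\<lambda>t::real. vscale X (complex_of_real t)"
  let ?H = "{(vadd X y (?s t a), r + t * \<alpha>) | y r t. (y, r) \<in> G}"
  have HI: "(x, q) \<in> ?H" if "(y, r) \<in> G" "x = vadd X y (?s t a)" "q = r + t * \<alpha>" for x q y r t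
    using that by blast
  have s: "?s t x \<in> points X" if "x \<in> points X" for t x using that by (rule scale_closed)
  have bound: "r + t * \<alpha> \<le> C * vnorm X (vadd X y (?s t a))" if yr: "(y, r) \<in> G" for y r t
  proof -
    have y: "y \<in> points X" using dominated_graphD(1)[OF G yr] .
    \<comment> \<open>For nonzero t, y + t a = |t| (y/|t| + sgn(t) a). This reduces domination to
      the coefficients 1 and -1, for which \<open>\<alpha>\<close> was chosen.\<close>
    have resc: "?s \<bar>t\<bar> (vadd X (?s (1 / \<bar>t\<bar>) y) (vscale X (sgn t) a)) = vadd X y (?s t a)"
      and nrm: "\<bar>t\<bar> * vnorm X (vadd X (?s (1 / \<bar>t\<bar>) y) (vscale X (sgn t) a))
        = vnorm X (vadd X y (?s t a))" if "t \<noteq> 0"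
    proof -
      have "complex_of_real \<bar>t\<bar> * complex_of_real (sgn t) = complex_of_real t"
        by (metis abs_mult_sgn of_real_mult)
      then show eq: "?s \<bar>t\<bar> (vadd X (?s (1 / \<bar>t\<bar>) y) (vscale X (sgn t) a)) = vadd X y (?s t a)"
        using that y a s
        by (simp add: scale_add_right scale_closed scale_scale scale_one del: of_real_divide
            flip: of_real_mult)
      show "\<bar>t\<bar> * vnorm X (vadd X (?s (1 / \<bar>t\<bar>) y) (vscale X (sgn t) a))
        = vnorm X (vadd X y (?s t a))"
        using norm_scale[of "vadd X (?s (1 / \<bar>t\<bar>) y) (vscale X (sgn t) a)" "complex_of_real \<bar>t\<bar>"]
          y a eq by (simp add: add_closed scale_closed)
    qed
    consider "t = 0" | "t > 0" | "t < 0" by linarith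
    then show ?thesis
    proof cases
      case 1
      then show ?thesis
        using dominated_graphD(5)[OF G yr] y a by (simp add: scale_zero_left add_zero)
    next
      case 2
      have "1 / \<bar>t\<bar> * r + \<alpha> \<le> C * vnorm X (vadd X (?s (1 / \<bar>t\<bar>) y) a)"
        using plus[OF dominated_graphD(4)[OF G yr]] .
      then have "\<bar>t\<bar> * (1 / \<bar>t\<bar> * r + \<alpha>) \<le> C * (\<bar>t\<bar> * vnorm X (vadd X (?s (1 / \<bar>t\<bar>) y) a))"
        by (metis abs_ge_zero mult.left_commute mult_left_mono)
      moreover have "\<bar>t\<bar> * (1 / \<bar>t\<bar> * r + \<alpha>) = r + t * \<alpha>" using 2 by (simp add: field_simps)
      moreover have "\<bar>t\<bar> * vnorm X (vadd X (?s (1 / \<bar>t\<bar>) y) a) = vnorm X (vadd X y (?s t a))"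
        using nrm 2 a by (simp add: scale_one)
      ultimately show ?thesis by simp
    next
      case 3
      have "1 / \<bar>t\<bar> * r - \<alpha> \<le> C * vnorm X (vadd X (?s (1 / \<bar>t\<bar>) y) (vscale X (-1) a))"
        using minus[OF dominated_graphD(4)[OF G yr]] .
      then have "\<bar>t\<bar> * (1 / \<bar>t\<bar> * r - \<alpha>)
          \<le> C * (\<bar>t\<bar> * vnorm X (vadd X (?s (1 / \<bar>t\<bar>) y) (vscale X (-1) a)))"
        by (metis abs_ge_zero mult.left_commute mult_left_mono)
      moreover have "\<bar>t\<bar> * (1 / \<bar>t\<bar> * r - \<alpha>) = r + t * \<alpha>" using 3 by (simp add: field_simps)
      moreover have "\<bar>t\<bar> * vnorm X (vadd X (?s (1 / \<bar>t\<bar>) y) (vscale X (-1) a))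
          = vnorm X (vadd X y (?s t a))"
        using nrm 3 by simp
      ultimately show ?thesis by simp
    qed
  qed
  have "dominated_graph C ?H"
    unfolding dominated_graph_def
  proof (intro conjI allI impI)
    show "?H \<subseteq> points X \<times> UNIV"
      using dominated_graphD(1)[OF G] s[OF a] add_closed by blast
    show "(vzero X, 0) \<in> ?H"
      by (rule HI[OF dominated_graphD(2)[OF G], of _ 0])
        (simp_all add: a scale_zero_left add_zero zero_closed)
  next
    fix x q x' q' assume "(x, q) \<in> ?H" "(x', q') \<in> ?H"
    then obtain y r t y' r' t' where yr: "(y, r) \<in> G" "(y', r') \<in> G"
      and x: "x = vadd X y (?s t a)" "x' = vadd X y' (?s t' a)"
      and q: "q = r + t * \<alpha>" "q' = r' + t' * \<alpha>"
      by blast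
    have y: "y \<in> points X" "y' \<in> points X" using yr dominated_graphD(1)[OF G] by blast+
    have "vadd X x x' = vadd X (vadd X y y') (?s (t + t') a)"
      unfolding x using y a s
      by (simp add: scale_add_left add_assoc add_closed add_left_commute)
    then show "(vadd X x x', q + q') \<in> ?H"
      by (rule HI[OF dominated_graphD(3)[OF G yr]]) (simp add: q algebra_simps)
  next
    fix x q u assume "(x, q) \<in> ?H"
    then obtain y r t where yr: "(y, r) \<in> G" and x: "x = vadd X y (?s t a)"
      and q: "q = r + t * \<alpha>"
      by blast
    have y: "y \<in> points X" using yr dominated_graphD(1)[OF G] by blast
    have "?s u x = vadd X (?s u y) (?s (u * t) a)"
      unfolding x using y a s by (simp add: scale_add_right scale_scale)
    then show "(?s u x, u * q) \<in> ?H"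
      by (rule HI[OF dominated_graphD(4)[OF G yr]]) (simp add: q algebra_simps)
  next
    fix x q assume "(x, q) \<in> ?H"
    then show "q \<le> C * vnorm X x" using bound by blast
  qed
  moreover have "G \<subseteq> ?H"
  proof (rule subrelI)
    fix y r assume yr: "(y, r) \<in> G"
    show "(y, r) \<in> ?H"
      by (rule HI[OF yr, of _ 0])
        (simp_all add: a scale_zero_left add_zero dominated_graphD(1)[OF G yr])
  qed
  moreover have "(a, \<alpha>) \<in> ?H"
    by (rule HI[OF dominated_graphD(2)[OF G], of _ 1])
      (simp_all add: a scale_one add_zero zero_closed add_commute[OF zero_closed])
  ultimately show ?thesis using that by blast
qed

lemma dominated_graph_Union:
  assumes ch: "subset.chain {H. dominated_graph C H} \<C>" and ne: "\<C> \<noteq> {}"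
  shows "dominated_graph C (\<Union>\<C>)"
proof -
  have dom: "dominated_graph C H" if "H \<in> \<C>" for H
    using ch that unfolding subset.chain_def by blast
  obtain H0 where H0: "H0 \<in> \<C>" using ne by blast
  show ?thesis
    unfolding dominated_graph_def
  proof (intro conjI allI impI)
    show "\<Union>\<C> \<subseteq> points X \<times> UNIV"
      using dom unfolding dominated_graph_def by blast
    show "(vzero X, 0) \<in> \<Union>\<C>"
      using H0 dominated_graphD(2)[OF dom[OF H0]] by blast
  next
    fix x r y s assume "(x, r) \<in> \<Union>\<C>" "(y, s) \<in> \<Union>\<C>"
    then obtain H K where HK: "H \<in> \<C>" "K \<in> \<C>" "(x, r) \<in> H" "(y, s) \<in> K" by blast
    \<comment> \<open>In a chain the union of two members is the larger one, so both pairs lie in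
      one dominated graph.\<close>
    then have "H \<union> K \<in> \<C>"
      using ch unfolding subset_chain_def by (metis sup.absorb1 sup.absorb2)
    moreover from this have "(vadd X x y, r + s) \<in> H \<union> K"
      using HK by (intro dominated_graphD(3)[OF dom]) blast+
    ultimately show "(vadd X x y, r + s) \<in> \<Union>\<C>" by blast
  next
    fix x r t assume "(x, r) \<in> \<Union>\<C>"
    then obtain H where "H \<in> \<C>" "(x, r) \<in> H" by blast
    then show "(vscale X (complex_of_real t) x, t * r) \<in> \<Union>\<C>"
      using dominated_graphD(4)[OF dom] by blast
  next
    fix x r assume "(x, r) \<in> \<Union>\<C>"
    then obtain H where "H \<in> \<C>" "(x, r) \<in> H" by blast
    then show "r \<le> C * vnorm X x" using dominated_graphD(5)[OF dom] by blast
  qed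
qed

text \<open>Zorn's lemma yields a maximal dominated graph containing \<open>G\<close>; the
  one-dimensional step shows that its domain is the whole space.\<close>

lemma dominated_graph_total_extension:
  assumes G: "dominated_graph C G" and C: "0 \<le> C"
  obtains g where "\<And>x r. (x, r) \<in> G \<Longrightarrow> g x = r"
    "\<And>x y. x \<in> points X \<Longrightarrow> y \<in> points X \<Longrightarrow> g (vadd X x y) = g x + g y"
    "\<And>x t. x \<in> points X \<Longrightarrow> g (vscale X (complex_of_real t) x) = t * g x"
    "\<And>x. x \<in> points X \<Longrightarrow> g x \<le> C * vnorm X x"
proof -
  let ?\<A> = "{H. dominated_graph C H \<and> G \<subseteq> H}"
  have "\<exists>M\<in>?\<A>. \<forall>H\<in>?\<A>. M \<subseteq> H \<longrightarrow> H = M"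
  proof (rule subset_Zorn_nonempty)
    show "?\<A> \<noteq> {}" using G by blast
    fix \<C> assume ne: "\<C> \<noteq> {}" and ch: "subset.chain ?\<A> \<C>"
    have "subset.chain {H. dominated_graph C H} \<C>"
      using ch unfolding subset.chain_def by blast
    moreover have "G \<subseteq> \<Union>\<C>" using ch ne unfolding subset.chain_def by blast
    ultimately show "\<Union>\<C> \<in> ?\<A>" using dominated_graph_Union ne by blast
  qed
  then obtain M where M: "dominated_graph C M" "G \<subseteq> M"
    and max: "\<And>H. dominated_graph C H \<Longrightarrow> M \<subseteq> H \<Longrightarrow> H = M"
    by fastforce
  \<comment> \<open>By maximality the extension of \<open>M\<close> by \<open>x\<close> is
    \<open>M\<close> itself, so \<open>M\<close> already has a value at \<open>x\<close>.\<close>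
  have "\<exists>r. (x, r) \<in> M" if "x \<in> points X" for x
    using dominated_graph_extend[OF M(1) C that] max by metis
  then obtain g where g: "\<And>x. x \<in> points X \<Longrightarrow> (x, g x) \<in> M" by metis
  have eq: "g x = r" if "(x, r) \<in> M" for x r
    using that g dominated_graphD(1)[OF M(1) that] dominated_graph_unique[OF M(1)] by blast
  show ?thesis
  proof
    show "g x = r" if "(x, r) \<in> G" for x r using eq M(2) that by blast
    show "g (vadd X x y) = g x + g y" if "x \<in> points X" "y \<in> points X" for x y
      using eq dominated_graphD(3)[OF M(1)] g that by blast
    show "g (vscale X (complex_of_real t) x) = t * g x" if "x \<in> points X" for x t
      using eq dominated_graphD(4)[OF M(1)] g that by blast
    show "g x \<le> C * vnorm X x" if "x \<in> points X" for x
      using dominated_graphD(5)[OF M(1)] g that by blast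
  qed
qed

section \<open>Complex-linear bounded functionals\<close>

definition bounded_functional :: "real \<Rightarrow> ('x \<Rightarrow> complex) \<Rightarrow> bool"
  where "bounded_functional C f \<longleftrightarrow>
    (\<forall>x\<in>points X. \<forall>y\<in>points X. f (vadd X x y) = f x + f y) \<and>
    (\<forall>c. \<forall>x\<in>points X. f (vscale X c x) = c * f x) \<and>
    (\<forall>x\<in>points X. cmod (f x) \<le> C * vnorm X x)"

lemma bounded_functionalD:
  assumes "bounded_functional C f" and "x \<in> points X"
  shows "y \<in> points X \<Longrightarrow> f (vadd X x y) = f x + f y"
    and "f (vscale X c x) = c * f x"
    and "cmod (f x) \<le> C * vnorm X x"
  using assms unfolding bounded_functional_def by blast+

text \<open>The functional to be extended is given by its graph, so that no separate argument for
  its well-definedness is needed: domination forces \<open>G\<close> to be single-valued.\<close>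

theorem Hahn_Banach:
  assumes sub: "G \<subseteq> points X \<times> UNIV" and zero: "(vzero X, 0) \<in> G"
    and add: "\<And>x r y s. (x, r) \<in> G \<Longrightarrow> (y, s) \<in> G \<Longrightarrow> (vadd X x y, r + s) \<in> G"
    and scale: "\<And>x r c. (x, r) \<in> G \<Longrightarrow> (vscale X c x, c * r) \<in> G"
    and bound: "\<And>x r. (x, r) \<in> G \<Longrightarrow> cmod r \<le> C * vnorm X x" and C: "0 \<le> C"
  obtains f where "bounded_functional C f" "\<And>x r. (x, r) \<in> G \<Longrightarrow> f x = r"
proof -
  \<comment> \<open>The real parts form a real functional dominated by the norm; it is extended
    first, and the complex functional is rebuilt from it.\<close>
  let ?R = "(\<lambda>(x, r). (x, Re r)) ` G"
  have R: "dominated_graph C ?R"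
    unfolding dominated_graph_def
  proof (intro conjI allI impI)
    show "?R \<subseteq> points X \<times> UNIV" using sub by auto
    show "(vzero X, 0) \<in> ?R" using zero by force
  next
    fix x r y s assume "(x, r) \<in> ?R" "(y, s) \<in> ?R"
    then obtain r' s' where "(x, r') \<in> G" "(y, s') \<in> G" "r = Re r'" "s = Re s'" by auto
    with add[of x r' y s'] show "(vadd X x y, r + s) \<in> ?R" by force
  next
    fix x r t assume "(x, r) \<in> ?R"
    then obtain r' where "(x, r') \<in> G" "r = Re r'" by auto
    with scale[of x r' "complex_of_real t"]
    show "(vscale X (complex_of_real t) x, t * r) \<in> ?R" by force
  next
    fix x r assume "(x, r) \<in> ?R"
    then obtain r' where "(x, r') \<in> G" "r = Re r'" by auto
    with bound[of x r'] show "r \<le> C * vnorm X x" using complex_Re_le_cmod[of r'] by simp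
  qed
  obtain g where g: "\<And>x r. (x, r) \<in> ?R \<Longrightarrow> g x = r"
    and gadd: "\<And>x y. x \<in> points X \<Longrightarrow> y \<in> points X \<Longrightarrow> g (vadd X x y) = g x + g y"
    and gscale: "\<And>x t. x \<in> points X \<Longrightarrow> g (vscale X (complex_of_real t) x) = t * g x"
    and gle: "\<And>x. x \<in> points X \<Longrightarrow> g x \<le> C * vnorm X x"
    using dominated_graph_total_extension[OF R C] by blast
  have gRe: "g x = Re r" if "(x, r) \<in> G" for x r
    using g[of x "Re r"] that by force
  \<comment> \<open>A complex-linear functional is determined by its real part: f(x) = g(x) - i
    g(ix).\<close>
  define f where "f = (\<lambda>x. Complex (g x) (- g (vscale X \<i> x)))"
  have fadd: "f (vadd X x y) = f x + f y" if "x \<in> points X" "y \<in> points X" for x y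
    using that by (simp add: f_def complex_eq_iff gadd scale_add_right scale_closed)
  have fscale: "f (vscale X c x) = c * f x" if x: "x \<in> points X" for c x
  proof -
    have gc: "g (vscale X d x) = Re d * g x + Im d * g (vscale X \<i> x)" for d
    proof -
      have d: "complex_of_real (Re d) + complex_of_real (Im d) * \<i> = d"
        by (simp add: complex_eq_iff)
      have "vscale X d x =
          vadd X (vscale X (complex_of_real (Re d)) x) (vscale X (complex_of_real (Im d)) (vscale X \<i> x))"
        using x d scale_add_left[OF x, of "complex_of_real (Re d)" "complex_of_real (Im d) * \<i>"]
        by (simp add: scale_scale)
      then show ?thesis using x by (simp add: gadd gscale scale_closed)
    qed
    show ?thesis
      using x gc[of c] gc[of "\<i> * c"]
      by (simp add: f_def complex_eq_iff scale_scale algebra_simps)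
  qed
  have fle: "cmod (f x) \<le> C * vnorm X x" if x: "x \<in> points X" for x
  proof (cases "f x = 0")
    case True
    then show ?thesis using C norm_nonneg[OF x] by simp
  next
    case False
    \<comment> \<open>The unimodular \<open>u\<close> rotates \<open>f x\<close> onto its modulus,
      so that the bound on the real part \<open>g\<close> at \<open>u x\<close> bounds
      \<open>f x\<close> with the same constant.\<close>
    define u where "u = cnj (f x) / complex_of_real (cmod (f x))"
    have u: "cmod u = 1" using False by (simp add: u_def norm_divide)
    have "u * f x = complex_of_real (cmod (f x))"
      using False complex_norm_square[of "f x"] by (simp add: u_def power2_eq_square field_simps)
    then have "cmod (f x) = g (vscale X u x)"
      using fscale[OF x, of u] by (simp add: f_def complex_eq_iff)
    also have "\<dots> \<le> C * vnorm X x"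
      using gle[OF scale_closed[OF x, of u]] norm_scale[OF x, of u] u by simp
    finally show ?thesis .
  qed
  show ?thesis
  proof
    show "bounded_functional C f"
      using fadd fscale fle unfolding bounded_functional_def by blast
    \<comment> \<open>The value of \<open>g\<close> at \<open>x\<close> is the real part of
      \<open>r\<close>; at \<open>\<i> x\<close> it is the real part of \<open>\<i> * r\<close>,
      that is, minus the imaginary part of \<open>r\<close>.\<close>
    show "f x = r" if xr: "(x, r) \<in> G" for x r
      using gRe[OF xr] gRe[OF scale[OF xr, of \<i>]] by (simp add: f_def complex_eq_iff)
  qed
qed

text \<open>The functional \<open>c x \<mapsto> c * ||x||\<close> on the line through
  \<open>x\<close> extends with bound 1. Such functionals separate points, and they are the summands
  of the gliding hump below.\<close>

corollary norming_functional:
  assumes x: "x \<in> points X"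
  obtains f where "bounded_functional 1 f" "f x = complex_of_real (vnorm X x)"
proof -
  let ?G = "{(vscale X c x, c * complex_of_real (vnorm X x)) | c. True}"
  have GI: "(y, r) \<in> ?G" if "y = vscale X c x" "r = c * complex_of_real (vnorm X x)" for y r c
    using that by blast
  obtain f where f: "bounded_functional 1 f" "\<And>y r. (y, r) \<in> ?G \<Longrightarrow> f y = r"
  proof (rule Hahn_Banach)
    show "?G \<subseteq> points X \<times> UNIV" using x by (auto intro: scale_closed)
    show "(vzero X, 0) \<in> ?G" by (rule GI[of _ 0]) (simp_all add: x scale_zero_left)
    fix y r z s assume "(y, r) \<in> ?G" "(z, s) \<in> ?G"
    then obtain c d where "y = vscale X c x" "r = c * complex_of_real (vnorm X x)"
      "z = vscale X d x" "s = d * complex_of_real (vnorm X x)" by blast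
    then show "(vadd X y z, r + s) \<in> ?G"
      by (intro GI[of _ "c + d"]) (simp_all add: x scale_add_left algebra_simps)
  next
    fix y r d assume "(y, r) \<in> ?G"
    then obtain c where "y = vscale X c x" "r = c * complex_of_real (vnorm X x)" by blast
    then show "(vscale X d y, d * r) \<in> ?G"
      by (intro GI[of _ "d * c"]) (simp_all add: x scale_scale)
  next
    show "cmod r \<le> 1 * vnorm X y" if "(y, r) \<in> ?G" for y r
      using that x norm_nonneg[OF x] by (auto simp: norm_scale norm_mult)
  qed auto
  show ?thesis
    by (rule that[OF f(1)], rule f(2), rule GI[of _ 1]) (simp_all add: x scale_one)
qed

section \<open>Weakly bounded sets\<close>

text \<open>Sokal's form of the gliding hump argument. The sign of each summand is chosen so that
  the partial sum after adding the \<open>n\<close>-th summand is large at \<open>y n\<close>, and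
  the geometric decay prevents the tail from destroying this.\<close>

lemma weakly_bounded_imp_bounded:
  assumes S: "S \<subseteq> points X"
    and weak: "\<And>C f. bounded_functional C f \<Longrightarrow> \<exists>B. \<forall>x\<in>S. cmod (f x) \<le> B"
  shows "\<exists>K. \<forall>x\<in>S. vnorm X x \<le> K"
proof (rule ccontr)
  assume contra: "\<not> ?thesis"
  \<comment> \<open>The base 4 exceeds the 3 in the weights \<open>(1 / 3) ^ n\<close> below, so the
    weighted norms still grow at least like \<open>(4 / 3) ^ n\<close>.\<close>
  have "\<exists>y\<in>S. 4 ^ n < vnorm X y" for n :: nat using contra by (meson not_le)
  then obtain y where yS: "\<And>n. y n \<in> S" and large: "\<And>n. 4 ^ n < vnorm X (y n)" by metis
  have y: "y n \<in> points X" for n using yS S by blast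
  have "\<exists>f. bounded_functional 1 f \<and> f (y n) = complex_of_real (vnorm X (y n))" for n
    using norming_functional[OF y] by metis
  then obtain \<eta> where \<eta>: "\<And>n. bounded_functional 1 (\<eta> n)"
    and \<eta>y: "\<And>n. \<eta> n (y n) = complex_of_real (vnorm X (y n))" by metis
  let ?q = "\<lambda>n x. (1 / 3) ^ n * \<eta> n x"
  define p where "p = rec_nat (\<lambda>_. 0) (\<lambda>n f.
      if (1 / 3) ^ n * vnorm X (y n) \<le> cmod (f (y n) + ?q n (y n))
      then (\<lambda>x. f x + ?q n x) else (\<lambda>x. f x - ?q n x))"
  have p_Suc: "p (Suc n) = (if (1 / 3) ^ n * vnorm X (y n) \<le> cmod (p n (y n) + ?q n (y n))
      then (\<lambda>x. p n x + ?q n x) else (\<lambda>x. p n x - ?q n x))" for n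
    by (simp add: p_def)
  \<comment> \<open>\<open>d n\<close> is the \<open>n\<close>-th summand with its chosen sign;
    \<open>p (Suc n)\<close> is the first partial sum containing it.\<close>
  define d where "d n x = p (Suc n) x - p n x" for n x
  have d: "(\<forall>x. d n x = ?q n x) \<or> (\<forall>x. d n x = - ?q n x)" for n
    by (simp add: d_def p_Suc)
  have d_add: "d n (vadd X x z) = d n x + d n z" if "x \<in> points X" "z \<in> points X" for n x z
    using d[of n] bounded_functionalD(1)[OF \<eta> that] by (auto simp: algebra_simps)
  have d_scale: "d n (vscale X c x) = c * d n x" if "x \<in> points X" for n c x
    using d[of n] bounded_functionalD(2)[OF \<eta> that] by auto
  have d_le: "cmod (d n x) \<le> (1 / 3) ^ n * vnorm X x" if "x \<in> points X" for n x
    using d[of n] bounded_functionalD(3)[OF \<eta> that, of n] by (auto simp: norm_mult norm_power)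
  have p_sum: "p n x = (\<Sum>k<n. d k x)" for n x
    by (induction n) (simp_all add: d_def p_def)
  have p_large: "(1 / 3) ^ n * vnorm X (y n) \<le> cmod (p (Suc n) (y n))" for n
  proof (cases "(1 / 3) ^ n * vnorm X (y n) \<le> cmod (p n (y n) + ?q n (y n))")
    case False
    \<comment> \<open>The two candidates for the new partial sum differ at \<open>y n\<close> by
      twice the required size, so if the one with plus falls short, the one with minus
      suffices.\<close>
    have "2 * ((1 / 3) ^ n * vnorm X (y n)) = cmod (2 * ?q n (y n))"
      using norm_nonneg[OF y[of n]] by (simp add: \<eta>y norm_mult norm_power)
    also have "\<dots> = cmod ((p n (y n) + ?q n (y n)) - (p n (y n) - ?q n (y n)))"
      by (simp add: algebra_simps)
    also have "\<dots> \<le> cmod (p n (y n) + ?q n (y n)) + cmod (p n (y n) - ?q n (y n))"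
      by (rule norm_triangle_ineq4)
    finally show ?thesis using False by (simp add: p_Suc)
  qed (simp add: p_Suc)
  \<comment> \<open>The factor 3/2 is 1/(1 - 1/3), from the geometric series.\<close>
  have geo: "(\<lambda>k. (1 / 3 :: real) ^ (k + n) * v) sums (3 / 2 * (1 / 3) ^ n * v)" for n v
    using sums_mult2[OF geometric_sums[of "1 / 3 :: real"], of "(1 / 3) ^ n * v"]
    by (simp add: power_add mult_ac)
  have summ: "summable (\<lambda>k. d (k + n) x)" if "x \<in> points X" for n x
    by (rule summable_comparison_test'[OF sums_summable[OF geo[of n "vnorm X x"]]])
      (use d_le[OF that] in simp)
  have tail: "cmod (\<Sum>k. d (k + n) x) \<le> 3 / 2 * (1 / 3) ^ n * vnorm X x" if "x \<in> points X" for n x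
  proof -
    have "cmod (\<Sum>k. d (k + n) x) \<le> (\<Sum>k. (1 / 3) ^ (k + n) * vnorm X x)"
      by (rule norm_suminf_le) (use d_le[OF that] geo sums_summable in blast)+
    then show ?thesis using sums_unique[OF geo[of n "vnorm X x"]] by simp
  qed
  define f where "f x = (\<Sum>k. d k x)" for x
  have summ0: "summable (\<lambda>k. d k x)" if "x \<in> points X" for x using summ[OF that, of 0] by simp
  have "bounded_functional (3 / 2) f"
    unfolding bounded_functional_def
  proof (intro conjI ballI allI)
    show "f (vadd X x z) = f x + f z" if "x \<in> points X" "z \<in> points X" for x z
      using that by (simp add: f_def d_add suminf_add summ0)
    show "f (vscale X c x) = c * f x" if "x \<in> points X" for c x
      using that by (simp add: f_def d_scale suminf_mult summ0)
    show "cmod (f x) \<le> 3 / 2 * vnorm X x" if "x \<in> points X" for x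
      using tail[OF that, of 0] by (simp add: f_def)
  qed
  then obtain B where B: "\<And>x. x \<in> S \<Longrightarrow> cmod (f x) \<le> B" using weak by blast
  have lower: "(4 / 3) ^ n \<le> 2 * B" for n
  proof -
    \<comment> \<open>Split after the summand with index \<open>n\<close>. The tail starts at
      \<open>Suc n\<close>, so its factor is 3/2 * 1/3 = 1/2: it can cancel at most half of the hump
      at \<open>y n\<close>, which leaves the bound \<open>2 * B\<close>.\<close>
    have "f (y n) = (\<Sum>k. d (k + Suc n) (y n)) + p (Suc n) (y n)"
      unfolding f_def p_sum by (rule suminf_split_initial_segment[OF summ0[OF y]])
    then have "cmod (p (Suc n) (y n)) \<le> cmod (f (y n)) + cmod (\<Sum>k. d (k + Suc n) (y n))"
      by (metis add_diff_cancel_left' norm_triangle_ineq4)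
    also have "\<dots> \<le> B + 1 / 2 * (1 / 3) ^ n * vnorm X (y n)"
      using B[OF yS] tail[of "y n" "Suc n", OF y] by (intro add_mono) simp_all
    finally have "(1 / 3) ^ n * vnorm X (y n) \<le> 2 * B"
      using p_large[of n] by simp
    moreover have "(4 / 3) ^ n \<le> (1 / 3) ^ n * vnorm X (y n)"
      using large[of n] by (simp add: power_divide divide_right_mono)
    ultimately show ?thesis by simp
  qed
  obtain n where "2 * B < (4 / 3 :: real) ^ n" using real_arch_pow[of "4 / 3" "2 * B"] by auto
  with lower[of n] show False by simp
qed

end


section \<open>Bounded linear maps\<close>

interpretation scaleC: vector_space "scaleC :: complex \<Rightarrow> 'a \<Rightarrow> 'a::complex_banach_algebra"
  by (rule vector_space_scaleC)

lemma complex_linear_iff: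
  "Vector_Spaces.linear scaleC (*) f \<longleftrightarrow>
    (\<forall>x y. f (x + y) = f x + f y) \<and> (\<forall>c (x :: 'a::complex_banach_algebra). f (c *\<^sub>C x) = c * f x)"
proof -
  have "vector_space ((*) :: complex \<Rightarrow> complex \<Rightarrow> complex)"
    by standard (simp_all add: algebra_simps)
  moreover have "vector_space (scaleC :: complex \<Rightarrow> 'a \<Rightarrow> 'a)"
    by (rule vector_space_scaleC)
  ultimately show ?thesis
    by (auto simp: Vector_Spaces.linear_def module_hom_def module_hom_axioms_def vector_space_def
        module_def)
qed

lemma scaleC_minus_one: "(-1) *\<^sub>C x = - (x :: 'a::complex_banach_algebra)"
  using scaleR_scaleC[of "-1" x] by simp

text \<open>Rescaling \<open>u\<close> to norm \<open>\<delta> / 2\<close> puts it inside the ball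
  where \<open>N\<close> is bounded. Stated for an absolutely homogeneous \<open>N\<close>, it
  serves both the continuity criterion and the final estimate for the factor map, with
  \<open>N u = vnorm X (T u)\<close>.\<close>

lemma homogeneous_bound:
  fixes V :: "'a::complex_banach_algebra set" and N :: "'a \<Rightarrow> real"
  assumes V: "scaleC.subspace V" and hom: "\<And>c u. u \<in> V \<Longrightarrow> N (c *\<^sub>C u) = cmod c * N u"
    and \<delta>: "0 < \<delta>" and N: "\<And>u. u \<in> V \<Longrightarrow> norm u < \<delta> \<Longrightarrow> N u \<le> K" and u: "u \<in> V"
  shows "N u \<le> 2 * K / \<delta> * norm u"
proof (cases "u = 0")
  case True
  then show ?thesis using hom[OF u, of 0] by simp
next
  case False
  define c where "c = complex_of_real (\<delta> / (2 * norm u))"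
  have c: "cmod c = \<delta> / (2 * norm u)" unfolding c_def norm_of_real using \<delta> by simp
  have "norm (c *\<^sub>C u) < \<delta>" using False \<delta> by (simp add: norm_scaleC c)
  then have "cmod c * N u \<le> K"
    using N[of "c *\<^sub>C u"] hom[OF u] scaleC.subspace_scale[OF V u] by simp
  then show ?thesis using False \<delta> by (simp add: c field_simps)
qed

context complex_normed_space
begin

text \<open>The subspace topology on \<open>V\<close> is that of the restricted distance, so
  continuity takes its epsilon-delta form.\<close>

lemma continuous_map_into_vtopology_iff:
  fixes T :: "'a::metric_space \<Rightarrow> 'x"
  shows "continuous_map (top_of_set V) (vtopology X) T \<longleftrightarrow>
    T ` V \<subseteq> points X \<and>
    (\<forall>u\<in>V. \<forall>\<epsilon>>0. \<exists>\<delta>>0. \<forall>v. v \<in> V \<and> dist u v < \<delta> \<longrightarrow> vdist X (T u) (T v) < \<epsilon>)"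
proof -
  interpret V: Submetric UNIV dist V
    by unfold_locales simp
  show ?thesis
    using V.sub.metric_continuous_map[OF Metric_space_axioms, of T]
    by (simp add: V.mtopology_submetric vtopology_def)
qed

lemma linear_into_diff:
  assumes V: "scaleC.subspace V" and T: "linear_into V X T" and u: "u \<in> V" and v: "v \<in> V"
  shows "T (u - v) = vadd X (T u) (vscale X (-1) (T v))"
proof -
  have "(-1) *\<^sub>C v \<in> V" using scaleC.subspace_scale[OF V v] .
  then have "T (u + (-1) *\<^sub>C v) = vadd X (T u) (vscale X (-1) (T v))"
    using T u v unfolding linear_into_def by metis
  then show ?thesis by (simp add: scaleC_minus_one)
qed

text \<open>Continuity at 0 bounds \<open>T\<close> on a small ball, hence everywhere by
  homogeneity. Conversely, a bound makes \<open>T\<close> Lipschitz, since the distance of two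
  values is the norm of \<open>T\<close> at the difference.\<close>

lemma linear_into_continuous_iff_bounded:
  fixes T :: "'a::complex_banach_algebra \<Rightarrow> 'x"
  assumes V: "scaleC.subspace V" and T: "linear_into V X T"
  shows "continuous_map (top_of_set V) (vtopology X) T \<longleftrightarrow>
    (\<exists>B\<ge>0. \<forall>u\<in>V. vnorm X (T u) \<le> B * norm u)"
proof -
  have cl: "T u \<in> points X" if "u \<in> V" for u using T that unfolding linear_into_def by blast
  have scale: "T (c *\<^sub>C u) = vscale X c (T u)" if "u \<in> V" for c u
    using T that unfolding linear_into_def by blast
  have dist_eq: "vdist X (T u) (T v) = vnorm X (T (u - v))" if "u \<in> V" "v \<in> V" for u v
    using linear_into_diff[OF V T that] cl that by (simp add: vdist_def)
  have diff: "u - v \<in> V" if "u \<in> V" "v \<in> V" for u v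
    using scaleC.subspace_diff[OF V that] .
  show ?thesis
    unfolding continuous_map_into_vtopology_iff
  proof (intro iffI conjI)
    assume L: "T ` V \<subseteq> points X \<and>
      (\<forall>u\<in>V. \<forall>\<epsilon>>0. \<exists>\<delta>>0. \<forall>v. v \<in> V \<and> dist u v < \<delta> \<longrightarrow> vdist X (T u) (T v) < \<epsilon>)"
    have zero: "0 \<in> V" using scaleC.subspace_0[OF V] .
    from L zero obtain \<delta> where \<delta>: "\<delta> > 0"
      and close: "\<And>v. v \<in> V \<Longrightarrow> dist 0 v < \<delta> \<Longrightarrow> vdist X (T 0) (T v) < 1"
      using zero_less_one by metis
    have small: "vnorm X (T u) \<le> 1" if "u \<in> V" "norm u < \<delta>" for u
      using close[OF that(1)] that dist_eq[OF that(1) zero] by (simp add: commute)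
    have "vnorm X (T u) \<le> 2 * 1 / \<delta> * norm u" if "u \<in> V" for u
      using homogeneous_bound[OF V, of "\<lambda>u. vnorm X (T u)" \<delta> 1 u] \<delta> small that
      by (simp add: scale norm_scale cl)
    with \<delta> show "\<exists>B\<ge>0. \<forall>u\<in>V. vnorm X (T u) \<le> B * norm u"
      by (intro exI[of _ "2 * 1 / \<delta>"]) simp
  next
    show "T ` V \<subseteq> points X" using cl by blast
    assume "\<exists>B\<ge>0. \<forall>u\<in>V. vnorm X (T u) \<le> B * norm u"
    then obtain B where B: "B \<ge> 0" "\<And>u. u \<in> V \<Longrightarrow> vnorm X (T u) \<le> B * norm u" by blast
    show "\<forall>u\<in>V. \<forall>\<epsilon>>0. \<exists>\<delta>>0. \<forall>v. v \<in> V \<and> dist u v < \<delta> \<longrightarrow> vdist X (T u) (T v) < \<epsilon>"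
    proof (intro ballI allI impI)
      fix u and \<epsilon> :: real assume u: "u \<in> V" and \<epsilon>: "\<epsilon> > 0"
      show "\<exists>\<delta>>0. \<forall>v. v \<in> V \<and> dist u v < \<delta> \<longrightarrow> vdist X (T u) (T v) < \<epsilon>"
      proof (intro exI[of _ "\<epsilon> / (B + 1)"] conjI allI impI)
        show "0 < \<epsilon> / (B + 1)" using \<epsilon> B(1) by simp
        fix v assume v: "v \<in> V \<and> dist u v < \<epsilon> / (B + 1)"
        have "vdist X (T u) (T v) \<le> B * dist u v"
          using B(2)[OF diff[of u v]] u v dist_eq by (simp add: dist_norm)
        also have "\<dots> \<le> (B + 1) * dist u v" by (simp add: mult_right_mono)
        also have "\<dots> < \<epsilon>" using v B(1) by (simp add: pos_less_divide_eq mult.commute)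
        finally show "vdist X (T u) (T v) < \<epsilon>" .
      qed
    qed
  qed
qed

lemma bounded_functional_continuous:
  assumes f: "bounded_functional C f"
  shows "continuous_map (vtopology X) euclidean f"
proof -
  have "\<exists>\<delta>>0. \<forall>y. y \<in> points X \<and> vdist X x y < \<delta> \<longrightarrow> dist (f x) (f y) < \<epsilon>"
    if x: "x \<in> points X" and \<epsilon>: "\<epsilon> > 0" for x \<epsilon>
  \<comment> \<open>The sign of \<open>C\<close> is unspecified; \<open>\<bar>C\<bar> + 1\<close> is
    a positive number above it.\<close>
  proof (intro exI[of _ "\<epsilon> / (\<bar>C\<bar> + 1)"] conjI allI impI)
    show "0 < \<epsilon> / (\<bar>C\<bar> + 1)" using \<epsilon> by simp
    fix y assume "y \<in> points X \<and> vdist X x y < \<epsilon> / (\<bar>C\<bar> + 1)"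
    then have y: "y \<in> points X" and d: "vdist X x y < \<epsilon> / (\<bar>C\<bar> + 1)" by simp_all
    have m: "vscale X (-1) y \<in> points X" using y by (rule scale_closed)
    have "f x - f y = f (vadd X x (vscale X (-1) y))"
      using bounded_functionalD(1)[OF f x m] bounded_functionalD(2)[OF f y] by simp
    then have "dist (f x) (f y) \<le> C * vdist X x y"
      using bounded_functionalD(3)[OF f add_closed[OF x m]] x y
      by (simp add: dist_norm vdist_def)
    also have "\<dots> \<le> (\<bar>C\<bar> + 1) * vdist X x y" by (intro mult_right_mono) auto
    also have "\<dots> < \<epsilon>" using d by (simp add: pos_less_divide_eq mult.commute)
    finally show "dist (f x) (f y) < \<epsilon>" .
  qed
  then show ?thesis
    using metric_continuous_map[OF Met_TC.Metric_space_axioms, of f]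
    by (simp add: vtopology_def)
qed

end

section \<open>The scalar field and the algebra as Banach spaces\<close>

text \<open>The Banach spaces of the theorem live on subsets of one type, which need not be
  \<open>complex\<close>. The scalar field enters that type by transport of structure along an
  injection \<open>j\<close>.\<close>

definition complex_copy :: "(complex \<Rightarrow> 'x) \<Rightarrow> 'x complex_normed_struct"
  where "complex_copy j = \<lparr>points = range j, vadd = (\<lambda>x y. j (inv j x + inv j y)), vzero = j 0,
    vscale = (\<lambda>c x. j (c * inv j x)), vnorm = (\<lambda>x. cmod (inv j x))\<rparr>"

lemma complex_copy_simps [simp]:
  "points (complex_copy j) = range j"
  "vadd (complex_copy j) = (\<lambda>x y. j (inv j x + inv j y))"
  "vzero (complex_copy j) = j 0"
  "vscale (complex_copy j) = (\<lambda>c x. j (c * inv j x))"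
  "vnorm (complex_copy j) = (\<lambda>x. cmod (inv j x))"
  by (simp_all add: complex_copy_def)

context
  fixes j :: "complex \<Rightarrow> 'x"
  assumes j: "inj j"
begin

lemma complex_normed_space_complex_copy: "complex_normed_space (complex_copy j)"
proof
  fix x assume "x \<in> points (complex_copy j)"
  then show "\<exists>y\<in>points (complex_copy j). vadd (complex_copy j) x y = vzero (complex_copy j)"
    using j by (intro bexI[of _ "j (- inv j x)"]) auto
qed (use j in \<open>auto simp: algebra_simps norm_mult norm_triangle_ineq\<close>)

lemma vdist_complex_copy: "vdist (complex_copy j) (j z) (j w) = dist z w"
  using j by (simp add: vdist_def dist_norm)

text \<open>\<open>j\<close> is an isometry onto the carrier, so a Cauchy sequence pulls back to the
  scalars, and \<open>j\<close> carries its limit over.\<close>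

lemma complex_banach_space_complex_copy: "complex_banach_space (complex_copy j)"
proof -
  interpret complex_normed_space "complex_copy j" by (rule complex_normed_space_complex_copy)
  have mcomplete
    unfolding mcomplete_def
  proof (intro allI impI)
    fix \<sigma> assume \<sigma>: "MCauchy \<sigma>"
    define s where "s n = inv j (\<sigma> n)" for n
    have \<sigma>_eq: "\<sigma> = (\<lambda>n. j (s n))"
      using \<sigma>[unfolded MCauchy_def] by (auto simp: s_def fun_eq_iff f_inv_into_f subset_iff)
    have "Cauchy s"
      using \<sigma>[unfolded MCauchy_def] by (simp add: \<sigma>_eq vdist_complex_copy Cauchy_def)
    then obtain l where "s \<longlonglongrightarrow> l" using Cauchy_convergent convergent_def by blast
    then have "limitin mtopology \<sigma> (j l) sequentially"
      unfolding limitin_metric by (simp add: \<sigma>_eq vdist_complex_copy tendsto_iff)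
    then show "\<exists>x. limitin mtopology \<sigma> x sequentially" by blast
  qed
  then show ?thesis by unfold_locales
qed

lemma continuous_map_complex_copy:
  assumes "continuous_map Y euclidean f"
  shows "continuous_map Y (vtopology (complex_copy j)) (\<lambda>x. j (f x))"
proof -
  interpret complex_normed_space "complex_copy j" by (rule complex_normed_space_complex_copy)
  have "continuous_map (top_of_set UNIV) (vtopology (complex_copy j)) j"
    unfolding continuous_map_into_vtopology_iff by (auto simp: vdist_complex_copy)
  from continuous_map_compose[OF assms, of _ j] this show ?thesis
    by (simp add: o_def)
qed

lemma linear_into_complex_copy_iff:
  "linear_into V (complex_copy j) (\<lambda>u. j (f u)) \<longleftrightarrow>
    (\<forall>u\<in>V. \<forall>v\<in>V. f (u + v) = f u + f v) \<and> (\<forall>c. \<forall>u\<in>V. f (c *\<^sub>C u) = c * f u)"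
  using j by (auto simp: linear_into_def inj_eq)

end

text \<open>Taking \<open>j = id\<close> turns the criterion for maps into normed structures into
  one for scalar functionals.\<close>

lemma complex_linear_continuous_imp_bounded:
  fixes f :: "'a::complex_banach_algebra \<Rightarrow> complex"
  assumes lin: "Vector_Spaces.linear scaleC (*) f" and cont: "continuous_on UNIV f"
  obtains B where "0 \<le> B" "\<And>u. cmod (f u) \<le> B * norm u"
proof -
  interpret complex_normed_space "complex_copy (id :: complex \<Rightarrow> complex)"
    by (rule complex_normed_space_complex_copy) simp
  have "linear_into UNIV (complex_copy id) (\<lambda>u. id (f u))"
    using lin unfolding linear_into_complex_copy_iff[OF inj_on_id] complex_linear_iff by blast
  then show ?thesis
    using linear_into_continuous_iff_bounded[OF scaleC.subspace_UNIV, of "\<lambda>u. id (f u)"]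
      continuous_map_complex_copy[OF inj_on_id, of euclidean f] cont that
    by auto
qed

text \<open>Presenting the algebra as a structure makes the Hahn--Banach theorem for carriers
  available for it.\<close>

definition algebra_struct :: "'a::complex_banach_algebra complex_normed_struct"
  where "algebra_struct = \<lparr>points = UNIV, vadd = (+), vzero = 0, vscale = scaleC, vnorm = norm\<rparr>"

lemma algebra_struct_simps [simp]:
  "points algebra_struct = UNIV" "vadd algebra_struct = (+)" "vzero algebra_struct = 0"
  "vscale algebra_struct = scaleC" "vnorm algebra_struct = norm"
  by (simp_all add: algebra_struct_def)

lemma complex_normed_space_algebra_struct:
  "complex_normed_space (algebra_struct :: 'a::complex_banach_algebra complex_normed_struct)"
proof
  fix x :: 'a
  show "\<exists>y\<in>points algebra_struct. vadd algebra_struct x y = vzero algebra_struct"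
    by (intro bexI[of _ "- x"]) simp_all
qed (simp_all add: algebra_simps scaleC_add_left scaleC_add_right scaleC_scaleC scaleC_one
    norm_scaleC norm_triangle_ineq)

lemma vtopology_algebra_struct:
  "vtopology (algebra_struct :: 'a::complex_banach_algebra complex_normed_struct) = euclidean"
proof -
  have "vdist (algebra_struct :: 'a complex_normed_struct) = dist"
    by (simp add: fun_eq_iff vdist_def dist_norm scaleC_minus_one)
  then show ?thesis by (simp add: vtopology_def)
qed

section \<open>The span of the commutators and extension from subspaces\<close>

lemma subspace_commutator_span: "scaleC.subspace commutator_span"
  unfolding commutator_span_def by (rule scaleC.subspace_span)

lemma commutator_in_span: "commutator a b \<in> commutator_span"
  unfolding commutator_span_def by (rule scaleC.span_base) blast

lemma commutator_span_minimal:
  assumes "scaleC.subspace S" and "\<And>a b. commutator a b \<in> S"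
  shows "commutator_span \<subseteq> S"
  unfolding commutator_span_def by (rule scaleC.span_minimal) (use assms in auto)

lemma Hahn_Banach_algebra:
  fixes h :: "'a::complex_banach_algebra \<Rightarrow> complex"
  assumes V: "scaleC.subspace V"
    and add: "\<And>u v. u \<in> V \<Longrightarrow> v \<in> V \<Longrightarrow> h (u + v) = h u + h v"
    and scale: "\<And>c u. u \<in> V \<Longrightarrow> h (c *\<^sub>C u) = c * h u"
    and bound: "\<And>u. u \<in> V \<Longrightarrow> cmod (h u) \<le> B * norm u" and B: "0 \<le> B"
  obtains f where "Vector_Spaces.linear scaleC (*) f" "continuous_on UNIV f"
    "\<And>u. u \<in> V \<Longrightarrow> f u = h u"
proof -
  interpret A: complex_normed_space "algebra_struct :: 'a complex_normed_struct"
    by (rule complex_normed_space_algebra_struct)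
  have zero: "h 0 = 0" using scale[OF scaleC.subspace_0[OF V], of 0] by simp
  let ?G = "(\<lambda>u. (u, h u)) ` V"
  obtain f where f: "A.bounded_functional B f" and ext: "\<And>u r. (u, r) \<in> ?G \<Longrightarrow> f u = r"
  proof (rule A.Hahn_Banach[of ?G B])
    show "(vzero algebra_struct, 0) \<in> ?G"
      using zero scaleC.subspace_0[OF V] by force
    show "(vadd algebra_struct u v, r + s) \<in> ?G" if "(u, r) \<in> ?G" "(v, s) \<in> ?G" for u r v s
      using that add scaleC.subspace_add[OF V] by force
    show "(vscale algebra_struct c u, c * r) \<in> ?G" if "(u, r) \<in> ?G" for u r c
      using that scale scaleC.subspace_scale[OF V] by force
    show "cmod r \<le> B * vnorm algebra_struct u" if "(u, r) \<in> ?G" for u r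
      using that bound by auto
  qed (use B in auto)
  show ?thesis
  proof
    show "Vector_Spaces.linear scaleC (*) f"
      using f by (simp add: A.bounded_functional_def complex_linear_iff)
    show "continuous_on UNIV f"
      using A.bounded_functional_continuous[OF f] by (simp add: vtopology_algebra_struct)
    show "f u = h u" if "u \<in> V" for u using ext that by blast
  qed
qed

section \<open>Factoring bilinear maps through the commutator\<close>

text \<open>The points of the span where \<open>S\<close> and \<open>T\<close> agree form a subspace
  containing all commutators.\<close>

lemma linear_into_eq_on_commutator_span:
  fixes S T :: "'a::complex_banach_algebra \<Rightarrow> 'x"
  assumes S: "linear_into commutator_span X S" and T: "linear_into commutator_span X T"
    and eq: "\<And>a b. S (commutator a b) = T (commutator a b)" and u: "u \<in> commutator_span"
  shows "S u = T u"
proof -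
  let ?E = "{u \<in> commutator_span. S u = T u}"
  have zero: "0 \<in> ?E"
    using eq[of 0 0] scaleC.subspace_0[OF subspace_commutator_span] by (simp add: commutator_def)
  have "scaleC.subspace ?E"
    by (rule scaleC.subspaceI)
      (use zero S T scaleC.subspace_add[OF subspace_commutator_span]
        scaleC.subspace_scale[OF subspace_commutator_span] in \<open>auto simp: linear_into_def\<close>)
  then have "commutator_span \<subseteq> ?E"
    by (rule commutator_span_minimal) (simp add: eq commutator_in_span)
  then show ?thesis using u by blast
qed

text \<open>Composing \<open>\<phi>\<close> with \<open>\<xi>\<close> gives a scalar bilinear map
  that satisfies the premises in the definition of a zero Lie product determined algebra.\<close>

lemma bounded_functional_factors:
  fixes \<phi> :: "'a::complex_banach_algebra \<Rightarrow> 'a \<Rightarrow> 'x"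
  assumes X: "complex_normed_space X"
    and zlpd: "zero_lie_product_determined TYPE('a)"
    and lin1: "\<And>a. linear_into UNIV X (\<lambda>b. \<phi> a b)"
    and lin2: "\<And>b. linear_into UNIV X (\<lambda>a. \<phi> a b)"
    and cont: "continuous_map euclidean (vtopology X) (\<lambda>(a, b). \<phi> a b)"
    and vanish: "\<And>a b. commutator a b = 0 \<Longrightarrow> \<phi> a b = vzero X"
    and \<xi>: "complex_normed_space.bounded_functional X C \<xi>"
  obtains \<tau> where "Vector_Spaces.linear scaleC (*) \<tau>" "continuous_on UNIV \<tau>"
    "\<And>a b. \<xi> (\<phi> a b) = \<tau> (commutator a b)"
proof -
  interpret complex_normed_space X by (rule X)
  have \<phi>: "\<phi> a b \<in> points X" for a b using lin1 unfolding linear_into_def by blast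
  have "Vector_Spaces.linear scaleC (*) (\<lambda>b. \<xi> (\<phi> a b))" for a
    using lin1[of a] bounded_functionalD[OF \<xi> \<phi>] \<phi>
    by (simp add: linear_into_def complex_linear_iff)
  moreover have "Vector_Spaces.linear scaleC (*) (\<lambda>a. \<xi> (\<phi> a b))" for b
    using lin2[of b] bounded_functionalD[OF \<xi> \<phi>] \<phi>
    by (simp add: linear_into_def complex_linear_iff)
  moreover have "continuous_on UNIV (\<lambda>(a, b). \<xi> (\<phi> a b))"
    using continuous_map_compose[OF cont bounded_functional_continuous[OF \<xi>]]
    by (simp add: o_def case_prod_beta)
  moreover have "\<xi> (\<phi> a b) = 0" if "commutator a b = 0" for a b
    using vanish[OF that] bounded_functionalD(2)[OF \<xi> zero_closed, of 0]
    by (simp add: scale_zero_right)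
  ultimately show ?thesis
    using zlpd[unfolded zero_lie_product_determined_def, rule_format, of "\<lambda>a b. \<xi> (\<phi> a b)"] that
    by blast
qed

lemma factors_through_commutator:
  fixes \<phi> :: "'a::complex_banach_algebra \<Rightarrow> 'a \<Rightarrow> 'x"
  assumes X: "complex_normed_space X"
    and zlpd: "zero_lie_product_determined TYPE('a)"
    and lin1: "\<And>a. linear_into UNIV X (\<lambda>b. \<phi> a b)"
    and lin2: "\<And>b. linear_into UNIV X (\<lambda>a. \<phi> a b)"
    and cont: "continuous_map euclidean (vtopology X) (\<lambda>(a, b). \<phi> a b)"
    and vanish: "\<And>a b. commutator a b = 0 \<Longrightarrow> \<phi> a b = vzero X"
  obtains T where "linear_into commutator_span X T"
    "continuous_map (top_of_set commutator_span) (vtopology X) T"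
    "\<And>a b. \<phi> a b = T (commutator a b)"
proof -
  interpret complex_normed_space X by (rule X)
  let ?V = "commutator_span :: 'a set"
  have V: "scaleC.subspace ?V" by (rule subspace_commutator_span)
  have \<phi>: "\<phi> a b \<in> points X" for a b using lin1 unfolding linear_into_def by blast
  define dual_pair where "dual_pair \<xi> \<tau> \<longleftrightarrow> (\<exists>C. bounded_functional C \<xi>) \<and>
    Vector_Spaces.linear scaleC (*) \<tau> \<and> (\<forall>a b. \<xi> (\<phi> a b) = \<tau> (commutator a b))" for \<xi> \<tau>
  have dual: "\<exists>\<tau>. dual_pair \<xi> \<tau> \<and> continuous_on UNIV \<tau>" if "bounded_functional C \<xi>" for C \<xi>
    using bounded_functional_factors[OF assms that] that unfolding dual_pair_def by metis
  \<comment> \<open>\<open>R u x\<close> says that every functional sees \<open>x\<close> as the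
    value wanted at \<open>u\<close>. Since no representation of \<open>u\<close> as a combination
    of commutators is chosen, well-definedness of \<open>T\<close> becomes single-valuedness of
    \<open>R\<close>.\<close>
  define R where "R u x \<longleftrightarrow> x \<in> points X \<and> (\<forall>\<xi> \<tau>. dual_pair \<xi> \<tau> \<longrightarrow> \<xi> x = \<tau> u)" for u x
  have R_comm: "R (commutator a b) (\<phi> a b)" for a b
    using \<phi> by (simp add: R_def dual_pair_def)
  have R_scale: "R (c *\<^sub>C u) (vscale X c x)" if "R u x" for c u x
    unfolding R_def
  proof (intro conjI allI impI)
    show "vscale X c x \<in> points X" using that by (simp add: R_def scale_closed)
    fix \<xi> \<tau> assume d: "dual_pair \<xi> \<tau>"
    then obtain C where "bounded_functional C \<xi>" unfolding dual_pair_def by blast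
    then have "\<xi> (vscale X c x) = c * \<xi> x"
      using bounded_functionalD(2) that unfolding R_def by blast
    then show "\<xi> (vscale X c x) = \<tau> (c *\<^sub>C u)"
      using d that by (metis R_def dual_pair_def complex_linear_iff)
  qed
  have R_add: "R (u + v) (vadd X x y)" if "R u x" "R v y" for u v x y
    unfolding R_def
  proof (intro conjI allI impI)
    show "vadd X x y \<in> points X" using that by (simp add: R_def add_closed)
    fix \<xi> \<tau> assume d: "dual_pair \<xi> \<tau>"
    then obtain C where "bounded_functional C \<xi>" unfolding dual_pair_def by blast
    then have "\<xi> (vadd X x y) = \<xi> x + \<xi> y"
      using bounded_functionalD(1) that unfolding R_def by blast
    moreover have "\<xi> x = \<tau> u" "\<xi> y = \<tau> v" using d that by (simp_all add: R_def)
    ultimately show "\<xi> (vadd X x y) = \<tau> (u + v)"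
      using d by (simp add: dual_pair_def complex_linear_iff)
  qed
  have R_unique: "x = y" if "R u x" "R u y" for u x y
  proof -
    have x: "x \<in> points X" and y: "y \<in> points X" using that by (simp_all add: R_def)
    \<comment> \<open>The norming functional of the difference \<open>w\<close> takes equal values
      at \<open>x\<close> and \<open>y\<close>, so the norm of \<open>w\<close> is 0.\<close>
    define w where "w = vadd X x (vscale X (-1) y)"
    have w: "w \<in> points X" using x y by (simp add: w_def add_closed scale_closed)
    obtain \<xi> where \<xi>: "bounded_functional 1 \<xi>" and \<xi>w: "\<xi> w = complex_of_real (vnorm X w)"
      using norming_functional[OF w] by blast
    obtain \<tau> where "dual_pair \<xi> \<tau>" using dual[OF \<xi>] by blast
    then have "\<xi> x = \<xi> y" using that unfolding R_def by metis
    then have "\<xi> w = 0"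
      using bounded_functionalD[OF \<xi>] x y by (simp add: w_def scale_closed)
    then have "w = vzero X" using \<xi>w norm_eq_zero[OF w] by simp
    then show ?thesis using eq_if_diff_eq_zero[OF x y] by (simp add: w_def)
  qed
  have "R 0 (vzero X)"
    using R_scale[OF R_comm, of 0 0 0] scale_zero_left[OF \<phi>] by simp
  \<comment> \<open>The domain of \<open>R\<close> is a subspace containing the commutators, hence
    contains their span.\<close>
  then have "scaleC.subspace {u. \<exists>x. R u x}"
    using R_add R_scale by (intro scaleC.subspaceI) blast+
  then have "?V \<subseteq> {u. \<exists>x. R u x}"
    by (rule commutator_span_minimal) (use R_comm in blast)
  then have "\<forall>u\<in>?V. \<exists>x. R u x" by blast
  then obtain T where T: "\<And>u. u \<in> ?V \<Longrightarrow> R u (T u)" using bchoice by metis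
  have T_eq: "T u = x" if "u \<in> ?V" "R u x" for u x using R_unique[OF T] that by blast
  have T_points: "T u \<in> points X" if "u \<in> ?V" for u using T[OF that] by (simp add: R_def)
  have lin: "linear_into ?V X T"
    unfolding linear_into_def
    using T_points T_eq R_add[OF T T] R_scale[OF T] scaleC.subspace_add[OF V]
      scaleC.subspace_scale[OF V] by simp
  let ?S = "T ` {u \<in> ?V. norm u < 1}"
  have "\<exists>K. \<forall>x\<in>?S. vnorm X x \<le> K"
  proof (rule weakly_bounded_imp_bounded)
    show "?S \<subseteq> points X" using T_points by blast
    fix C \<xi> assume "bounded_functional C \<xi>"
    then obtain \<tau> where \<tau>: "dual_pair \<xi> \<tau>" "continuous_on UNIV \<tau>" using dual by blast
    then obtain B where B: "0 \<le> B" "\<And>u. cmod (\<tau> u) \<le> B * norm u"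
      using complex_linear_continuous_imp_bounded unfolding dual_pair_def by metis
    have "cmod (\<xi> (T u)) \<le> B" if "u \<in> ?V" "norm u < 1" for u
    proof -
      have "\<xi> (T u) = \<tau> u" using T[OF that(1)] \<tau>(1) by (simp add: R_def)
      then show ?thesis
        using B(2)[of u] mult_left_mono[OF less_imp_le[OF that(2)] B(1)] by simp
    qed
    then show "\<exists>B. \<forall>x\<in>?S. cmod (\<xi> x) \<le> B" by blast
  qed
  then obtain K where K: "\<And>u. u \<in> ?V \<Longrightarrow> norm u < 1 \<Longrightarrow> vnorm X (T u) \<le> K" by blast
  have "0 \<le> K"
    using K[of 0] scaleC.subspace_0[OF V] norm_nonneg[OF T_points[of 0]] by simp
  moreover have "vnorm X (T u) \<le> 2 * K / 1 * norm u" if "u \<in> ?V" for u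
  proof (rule homogeneous_bound[OF V _ zero_less_one K that])
    show "vnorm X (T (c *\<^sub>C v)) = cmod c * vnorm X (T v)" if "v \<in> ?V" for c v
      using that lin norm_scale[OF T_points] by (simp add: linear_into_def)
  qed
  ultimately have "\<exists>B\<ge>0. \<forall>u\<in>?V. vnorm X (T u) \<le> B * norm u"
    by (intro exI[of _ "2 * K"]) simp
  then have "continuous_map (top_of_set ?V) (vtopology X) T"
    using linear_into_continuous_iff_bounded[OF V lin] by blast
  with lin show ?thesis
    by (rule that) (use T_eq[OF commutator_in_span R_comm] in simp)
qed

text \<open>The quantifier over Banach spaces ranges over structures carried by subsets of
  \<open>'x\<close>; \<open>universe\<close> ensures that a copy of the scalar field is among them.
  Membership in \<open>extensional\<close> fixes \<open>T\<close> off the span, so that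
  \<open>\<exists>!\<close> expresses uniqueness of a map defined on the span.\<close>

theorem proposition3p1:
  assumes universe: "\<exists>j :: complex \<Rightarrow> 'x. inj j"
  shows "zero_lie_product_determined TYPE('a::complex_banach_algebra) \<longleftrightarrow>
    (\<forall>X :: 'x complex_normed_struct. complex_banach_space X \<longrightarrow>
      (\<forall>\<phi> :: 'a \<Rightarrow> 'a \<Rightarrow> 'x.
        (\<forall>a. linear_into UNIV X (\<lambda>b. \<phi> a b)) \<longrightarrow>
        (\<forall>b. linear_into UNIV X (\<lambda>a. \<phi> a b)) \<longrightarrow>
        continuous_map euclidean (vtopology X) (\<lambda>(a, b). \<phi> a b) \<longrightarrow>
        (\<forall>a b. commutator a b = 0 \<longrightarrow> \<phi> a b = vzero X) \<longrightarrow>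
        (\<exists>!T :: 'a \<Rightarrow> 'x.
          T \<in> extensional commutator_span \<and>
          linear_into commutator_span X T \<and>
          continuous_map (top_of_set commutator_span) (vtopology X) T \<and>
          (\<forall>a b. \<phi> a b = T (commutator a b)))))"
proof (intro iffI allI impI)
  fix X :: "'x complex_normed_struct" and \<phi> :: "'a \<Rightarrow> 'a \<Rightarrow> 'x"
  let ?V = "commutator_span :: 'a set"
  assume zlpd: "zero_lie_product_determined TYPE('a)" and X: "complex_banach_space X"
    and lin1: "\<forall>a. linear_into UNIV X (\<lambda>b. \<phi> a b)"
    and lin2: "\<forall>b. linear_into UNIV X (\<lambda>a. \<phi> a b)"
    and cont: "continuous_map euclidean (vtopology X) (\<lambda>(a, b). \<phi> a b)"
    and vanish: "\<forall>a b. commutator a b = 0 \<longrightarrow> \<phi> a b = vzero X"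
  have V: "scaleC.subspace ?V" by (rule subspace_commutator_span)
  have normed: "complex_normed_space X" using X by (rule complex_banach_space.axioms(1))
  obtain T where T: "linear_into ?V X T" "continuous_map (top_of_set ?V) (vtopology X) T"
    and \<phi>T: "\<And>a b. \<phi> a b = T (commutator a b)"
    by (rule factors_through_commutator[OF normed zlpd, of \<phi>]) (use lin1 lin2 cont vanish in auto)
  \<comment> \<open>Restriction sets the values off the span to \<open>undefined\<close>, as
    \<open>extensional\<close> demands.\<close>
  let ?T = "restrict T ?V"
  have "linear_into ?V X ?T"
    using T(1) scaleC.subspace_add[OF V] scaleC.subspace_scale[OF V]
    by (simp add: linear_into_def)
  moreover have "continuous_map (top_of_set ?V) (vtopology X) ?T"
    using T(2) by (rule continuous_map_eq) simp
  moreover have \<phi>_restrict: "\<phi> a b = ?T (commutator a b)" for a b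
    using \<phi>T commutator_in_span[of a b] by simp
  moreover have "S = ?T"
    if S: "S \<in> extensional ?V" "linear_into ?V X S" "\<forall>a b. \<phi> a b = S (commutator a b)" for S
  proof (rule extensionalityI[OF S(1)])
    show "?T \<in> extensional ?V" by simp
    show "S u = ?T u" if "u \<in> ?V" for u
      using S(2) \<open>linear_into ?V X ?T\<close> _ that
      by (rule linear_into_eq_on_commutator_span) (metis S(3) \<phi>_restrict)
  qed
  moreover have "?T \<in> extensional ?V" by simp
  ultimately show "\<exists>!T. T \<in> extensional ?V \<and> linear_into ?V X T \<and>
      continuous_map (top_of_set ?V) (vtopology X) T \<and> (\<forall>a b. \<phi> a b = T (commutator a b))"
    by (intro ex1I[of _ ?T] conjI allI) blast+
next
  assume R: "\<forall>X :: 'x complex_normed_struct. complex_banach_space X \<longrightarrow>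
      (\<forall>\<phi> :: 'a \<Rightarrow> 'a \<Rightarrow> 'x.
        (\<forall>a. linear_into UNIV X (\<lambda>b. \<phi> a b)) \<longrightarrow>
        (\<forall>b. linear_into UNIV X (\<lambda>a. \<phi> a b)) \<longrightarrow>
        continuous_map euclidean (vtopology X) (\<lambda>(a, b). \<phi> a b) \<longrightarrow>
        (\<forall>a b. commutator a b = 0 \<longrightarrow> \<phi> a b = vzero X) \<longrightarrow>
        (\<exists>!T :: 'a \<Rightarrow> 'x.
          T \<in> extensional commutator_span \<and>
          linear_into commutator_span X T \<and>
          continuous_map (top_of_set commutator_span) (vtopology X) T \<and>
          (\<forall>a b. \<phi> a b = T (commutator a b))))"
  obtain j :: "complex \<Rightarrow> 'x" where j: "inj j" using universe by blast
  let ?X = "complex_copy j" and ?V = "commutator_span :: 'a set"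
  interpret complex_normed_space ?X by (rule complex_normed_space_complex_copy[OF j])
  show "zero_lie_product_determined TYPE('a)"
    unfolding zero_lie_product_determined_def
  proof (intro allI impI)
    fix \<phi> :: "'a \<Rightarrow> 'a \<Rightarrow> complex"
    assume lin1: "\<forall>a. Vector_Spaces.linear scaleC (*) (\<lambda>b. \<phi> a b)"
      and lin2: "\<forall>b. Vector_Spaces.linear scaleC (*) (\<lambda>a. \<phi> a b)"
      and cont: "continuous_on UNIV (\<lambda>(a, b). \<phi> a b)"
      and vanish: "\<forall>a b. commutator a b = 0 \<longrightarrow> \<phi> a b = 0"
    have "\<forall>a. linear_into UNIV ?X (\<lambda>b. j (\<phi> a b))" "\<forall>b. linear_into UNIV ?X (\<lambda>a. j (\<phi> a b))"
      using lin1 lin2 by (simp_all add: linear_into_complex_copy_iff[OF j] complex_linear_iff)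
    moreover have "continuous_map euclidean (vtopology ?X) (\<lambda>(a, b). j (\<phi> a b))"
      using continuous_map_complex_copy[OF j, of euclidean "\<lambda>(a, b). \<phi> a b"] cont
      by (simp add: case_prod_unfold)
    moreover have "\<forall>a b. commutator a b = 0 \<longrightarrow> j (\<phi> a b) = vzero ?X"
      using vanish by simp
    ultimately have "\<exists>!T :: 'a \<Rightarrow> 'x. T \<in> extensional ?V \<and> linear_into ?V ?X T \<and>
        continuous_map (top_of_set ?V) (vtopology ?X) T \<and> (\<forall>a b. j (\<phi> a b) = T (commutator a b))"
      using R[rule_format, OF complex_banach_space_complex_copy[OF j], of "\<lambda>a b. j (\<phi> a b)"]
      by blast
    then obtain T where T: "linear_into ?V ?X T" "continuous_map (top_of_set ?V) (vtopology ?X) T"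
      and \<phi>T: "\<And>a b. j (\<phi> a b) = T (commutator a b)" by blast
    obtain B where B: "0 \<le> B" "\<And>u. u \<in> ?V \<Longrightarrow> vnorm ?X (T u) \<le> B * norm u"
      using T(2) linear_into_continuous_iff_bounded[OF subspace_commutator_span T(1)] by blast
    \<comment> \<open>\<open>T\<close>, read back as a scalar map by \<open>inv j\<close>, lives
      only on the span, whereas the definition asks for a functional on the whole algebra; the bound
      \<open>B\<close> permits the extension.\<close>
    obtain \<tau> where \<tau>: "Vector_Spaces.linear scaleC (*) \<tau>" "continuous_on UNIV \<tau>"
      and ext: "\<And>u. u \<in> ?V \<Longrightarrow> \<tau> u = inv j (T u)"
      by (rule Hahn_Banach_algebra[OF subspace_commutator_span, of "\<lambda>u. inv j (T u)" B])
        (use T(1) B j in \<open>auto simp: linear_into_def\<close>)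
    have "\<phi> a b = \<tau> (commutator a b)" for a b
      using ext[OF commutator_in_span, of a b] j by (simp flip: \<phi>T)
    with \<tau> show "\<exists>\<tau>. Vector_Spaces.linear scaleC (*) \<tau> \<and> continuous_on UNIV \<tau> \<and>
        (\<forall>a b. \<phi> a b = \<tau> (commutator a b))"
      by blast
  qed
qed

end
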